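(* Let $\alpha: I\to E^3$ be a Frenet curve with Frenet frame $\{T,N,B\}$, curvature $\kappa$ and torsion $\tau$, and let $\beta$ be an $X$-direction curve of $\alpha$, where $X=aT+bN+cB$ with $a,b,c$ smooth functions of $s$ satisfying $a^2+b^2+c^2=1$. Then $\beta$ is a Mannheim-direction curve of $\alpha$ if and only if $$a(s)=\sin\left(\int\kappa\,ds\right),\qquad b(s)=\cos\left(\int\kappa\,ds\right),\qquad c(s)=0.$$
   Context: $I\subset\mathbb{R}$ is an open interval and $E^3$ is Euclidean 3-space. A unit speed curve $\alpha:I\to E^3$ is a Frenet curve if its curvature $\kappa=\|\alpha''\|$ is nowhere zero; then $T=\alpha'$, $\alpha''=\kappa N$, $B=T\times N$, and $T'=\kappa N$, $N'=-\kappa T+\tau B$, $B'=-\tau N$, where $\tau$ is the torsion. For a unit vector valued function $X(s)=a(s)T(s)+b(s)N(s)+c(s)B(s)$ with $a,b,c$ smooth and $a^2+b^2+c^2=1$, an $X$-direction curve of $\alpha$ is a curve $\beta:I\to E^3$ that is an integral curve of $X$, i.e. $\beta'(s)=X(s)$; the arc length parameter $s$ of $\alpha$ is then also an arc length parameter of $\beta$. The Frenet vectors and curvatures of $\beta$ are denoted $\{\overline T,\overline N,\overline B\}$, $\overline\kappa,\overline\tau$. An $X$-direction curve $\beta$ of $\alpha$ is called a Mannheim-direction curve of $\alpha$ if $\beta$ is a Mannheim curve of $\alpha$ and $\alpha$ is a Mannheim partner curve of $\beta$; this relation is used in the form $\overline N=B$ at corresponding parameter values. $\int\kappa\,ds$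 denotes an indefinite integral of $\kappa$ with respect to $s$.
   Formalization: β is assumed to be a Frenet curve (if α is planar, the stated a, b, c make β a line without normal), and N̄ = B is read as N̄ = ±B with a constant sign on I, since β'' = τ cos(∫κ ds) B gives N̄ = −B when that coefficient is negative. *)

theory Defs
  imports "HOL-Analysis.Analysis"
begin

unbundle cross3_syntax

type_synonym curve = "real \<Rightarrow> real ^ 3"

(* Parameter derivative of a real- or vector-valued function. It is a total function, with an
   unspecified value where f is not differentiable; it is only used on an open interval on which
   the function is assumed to be smooth. *)
definition vderiv :: "(real \<Rightarrow> 'a::real_normed_vector) \<Rightarrow> real \<Rightarrow> 'a"
  where "vderiv f = (\<lambda>s. vector_derivative f (at s))"

(* C-infinity on an open set: every iterated derivative is differentiable at every point. *)
definition smooth_on :: "real set \<Rightarrow> (real \<Rightarrow> 'a::real_normed_vector) \<Rightarrow> bool"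
  where "smooth_on I f \<longleftrightarrow> (\<forall>n. \<forall>s\<in>I. ((vderiv ^^ n) f) differentiable (at s))"

definition tangent :: "curve \<Rightarrow> curve"
  where "tangent \<gamma> = vderiv \<gamma>"

definition curvature :: "curve \<Rightarrow> real \<Rightarrow> real"
  where "curvature \<gamma> s = norm (vderiv (vderiv \<gamma>) s)"

definition normal :: "curve \<Rightarrow> curve"
  where "normal \<gamma> s = (1 / curvature \<gamma> s) *\<^sub>R vderiv (vderiv \<gamma>) s"

definition binormal :: "curve \<Rightarrow> curve"
  where "binormal \<gamma> s = tangent \<gamma> s \<times> normal \<gamma> s"

definition frenet_curve :: "real set \<Rightarrow> curve \<Rightarrow> bool"
  where "frenet_curve I \<gamma> \<longleftrightarrow>
    smooth_on I \<gamma> \<and> (\<forall>s\<in>I. norm (tangent \<gamma> s) = 1) \<and> (\<forall>s\<in>I. curvature \<gamma> s \<noteq> 0)"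

definition direction_curve ::
  "real set \<Rightarrow> curve \<Rightarrow> (real \<Rightarrow> real) \<Rightarrow> (real \<Rightarrow> real) \<Rightarrow> (real \<Rightarrow> real) \<Rightarrow> curve \<Rightarrow> bool"
  where "direction_curve I \<alpha> a b c \<beta> \<longleftrightarrow>
    smooth_on I a \<and> smooth_on I b \<and> smooth_on I c \<and>
    (\<forall>s\<in>I. (a s)\<^sup>2 + (b s)\<^sup>2 + (c s)\<^sup>2 = 1) \<and>
    (\<forall>s\<in>I. (\<beta> has_vector_derivative
       (a s *\<^sub>R tangent \<alpha> s + b s *\<^sub>R normal \<alpha> s + c s *\<^sub>R binormal \<alpha> s)) (at s))"

(* beta is a Mannheim curve of alpha, and alpha a Mannheim partner curve of beta, with points
   corresponding at equal parameters: the principal normal of beta is the binormal of alpha.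
   The condition concerns normal lines, so the principal normal of beta is taken up to a choice
   of orientation, constant along the curve. With the fixed orientation of "normal", the equality
   without the sign would exclude every beta with second derivative tau cos(int kappa) B whose
   coefficient tau cos(int kappa), the signed curvature of beta, is negative. *)
definition mannheim_curve :: "real set \<Rightarrow> curve \<Rightarrow> curve \<Rightarrow> bool"
  where "mannheim_curve I \<alpha> \<beta> \<longleftrightarrow>
    frenet_curve I \<alpha> \<and> frenet_curve I \<beta> \<and>
    (\<exists>\<epsilon>\<in>{1, -1::real}. \<forall>s\<in>I. \<epsilon> *\<^sub>R normal \<beta> s = binormal \<alpha> s)"

definition mannheim_direction_curve :: "real set \<Rightarrow> curve \<Rightarrow> curve \<Rightarrow> bool"
  where "mannheim_direction_curve I \<alpha> \<beta> \<longleftrightarrow>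
    (\<exists>a b c. direction_curve I \<alpha> a b c \<beta>) \<and> mannheim_curve I \<alpha> \<beta>"

end

theory Submission
  imports Defs
begin

text \<open>
  Write \<open>D = \<beta>'\<close> for the direction field \<open>a T + b N + c B\<close>. The Mannheim condition says that
  \<open>D'\<close> is a nonzero multiple of \<open>B\<close> everywhere, with a factor of constant sign, and everything
  follows by reading off components of \<open>D'\<close> in the frame of \<open>\<alpha>\<close>.

  If \<open>D'\<close> is a nonzero multiple of \<open>B\<close>, then \<open>c = D \<bullet> B\<close> vanishes, because a unit vector field is
  orthogonal to its derivative. Hence \<open>D = a T + b N\<close>, and the \<open>T\<close>- and \<open>N\<close>-components of \<open>D'\<close>
  are \<open>a' - \<kappa> b\<close> and \<open>b' + \<kappa> a\<close>
  (\<open>osculating_direction_components\<close>). Both must vanish, so \<open>(b, a)\<close> turns on the unit circle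
  with angular velocity \<open>\<kappa>\<close>, and its polar angle is an indefinite integral of \<open>\<kappa>\<close>
  (\<open>angle_function_of_rotation\<close>).

  Conversely, for \<open>a = sin \<theta>\<close>, \<open>b = cos \<theta>\<close>, \<open>c = 0\<close> the two components vanish and
  \<open>D'\<close> is a multiple \<open>f B\<close> of \<open>B\<close>. Since \<open>\<beta>\<close> has nonzero curvature, the continuous function
  \<open>f\<close> has no zero, hence a constant sign on the interval, and this sign is the orientation
  relating \<open>N\<close> of \<open>\<beta>\<close> to \<open>B\<close>.

  Both directions rest on \<open>N' \<bullet> T = -\<kappa>\<close> and \<open>N' \<bullet> N = 0\<close>, obtained by differentiating the
  orthonormality relations of \<open>T\<close> and \<open>N\<close> (\<open>normal_derivative_components\<close>).
\<close>

section \<open>Calculus on open intervals\<close>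

text \<open>Anchoring the primitive at one interior point and integrating over compact subintervals
  covers bounded and unbounded intervals alike.\<close>

lemma primitive_on_open_interval:
  fixes k :: "real \<Rightarrow> real"
  assumes "open I" "is_interval I" "s0 \<in> I" "continuous_on I k"
  obtains F where "F s0 = 0" "\<And>s. s \<in> I \<Longrightarrow> (F has_real_derivative k s) (at s)"
proof -
  let ?F = "\<lambda>s. LBINT y=s0..s. k y"
  have "(?F has_real_derivative k s) (at s)" if "s \<in> I" for s
  proof -
    have "min s s0 \<in> I" "max s s0 \<in> I"
      using \<open>s \<in> I\<close> \<open>s0 \<in> I\<close> by (auto simp: min_def max_def)
    obtain d where d: "d > 0" "ball (min s s0) d \<subseteq> I"
      using \<open>open I\<close> \<open>min s s0 \<in> I\<close> by (meson openE)
    obtain e where e: "e > 0" "ball (max s s0) e \<subseteq> I"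
      using \<open>open I\<close> \<open>max s s0 \<in> I\<close> by (meson openE)
    define l where "l = min s s0 - d/2"
    define u where "u = max s s0 + e/2"
    have "l \<in> I" "u \<in> I" using d e by (auto simp: l_def u_def dist_real_def)
    have lu: "l < s" "s < u" "l < s0" "s0 < u" using d e by (auto simp: l_def u_def)
    have "{l..u} \<subseteq> I"
      using mem_is_interval_1_I[OF \<open>is_interval I\<close> \<open>l \<in> I\<close> \<open>u \<in> I\<close>] by auto
    then have "continuous_on {l..u} k" using \<open>continuous_on I k\<close> continuous_on_subset by blast
    then have "(?F has_vector_derivative k s) (at s within {l..u})"
      by (intro interval_integral_FTC2) (use lu in auto)
    then show ?thesis
      using at_within_interior[of s "{l..u}"] lu
      by (simp add: has_real_derivative_iff_has_vector_derivative)
  qed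
  then show thesis by (intro that[of ?F]) auto
qed

text \<open>An angle with the right derivative and the right initial value solves the same linear system
  as the given pair, and the squared distance of two solutions is constant because the system is
  skew-symmetric. This avoids lifting a circle-valued function to an angle.\<close>

lemma angle_function_of_rotation:
  fixes a b k :: "real \<Rightarrow> real"
  assumes I: "open I" "is_interval I" and k: "continuous_on I k"
    and unit: "\<And>s. s \<in> I \<Longrightarrow> (a s)\<^sup>2 + (b s)\<^sup>2 = 1"
    and a': "\<And>s. s \<in> I \<Longrightarrow> (a has_real_derivative k s * b s) (at s)"
    and b': "\<And>s. s \<in> I \<Longrightarrow> (b has_real_derivative - (k s * a s)) (at s)"
  shows "\<exists>\<theta>. (\<forall>s\<in>I. (\<theta> has_real_derivative k s) (at s)) \<and>
             (\<forall>s\<in>I. a s = sin (\<theta> s) \<and> b s = cos (\<theta> s))"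
proof (cases "I = {}")
  case False
  then obtain s0 where s0: "s0 \<in> I" by auto
  obtain F where F: "F s0 = 0" "\<And>s. s \<in> I \<Longrightarrow> (F has_real_derivative k s) (at s)"
    using primitive_on_open_interval[OF I s0 k] by blast
  obtain t where t: "b s0 = cos t" "a s0 = sin t"
    using sincos_total_2pi unit[OF s0] by (metis add.commute)
  define \<theta> where "\<theta> s = F s + t" for s
  have \<theta>': "(\<theta> has_real_derivative k s) (at s)" if "s \<in> I" for s
    unfolding \<theta>_def using F(2)[OF that] by (auto intro!: derivative_eq_intros)
  let ?g = "\<lambda>s. (a s - sin (\<theta> s))\<^sup>2 + (b s - cos (\<theta> s))\<^sup>2"
  have g': "(?g has_real_derivative 0) (at s within I)" if "s \<in> I" for s
  proof (rule has_field_derivative_at_within)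
    show "(?g has_real_derivative 0) (at s)"
      by (rule derivative_eq_intros a'[OF that] b'[OF that] \<theta>'[OF that] refl)+
         (simp add: algebra_simps)
  qed
  obtain c where c: "\<And>s. s \<in> I \<Longrightarrow> ?g s = c"
    using has_field_derivative_zero_constant[OF _ g'] \<open>is_interval I\<close> is_interval_convex by blast
  have "c = 0" using c[OF s0] t F(1) by (simp add: \<theta>_def)
  then have "a s = sin (\<theta> s) \<and> b s = cos (\<theta> s)" if "s \<in> I" for s
    using c[OF that] by (simp add: sum_power2_eq_zero_iff)
  with \<theta>' show ?thesis by blast
qed auto

lemma continuous_nonzero_constant_sign:
  fixes f :: "real \<Rightarrow> real"
  assumes "is_interval I" "continuous_on I f" "\<And>s. s \<in> I \<Longrightarrow> f s \<noteq> 0"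
  obtains \<epsilon> where "\<epsilon> \<in> {1, -1::real}" "\<And>s. s \<in> I \<Longrightarrow> f s = \<epsilon> * \<bar>f s\<bar>"
proof -
  have "connected (f ` I)"
    using assms by (auto intro: connected_continuous_image simp: is_interval_connected)
  then have *: "0 \<in> f ` I" if "x \<in> I" "y \<in> I" "f x < 0" "0 < f y" for x y
    using that connectedD_interval[of "f ` I" "f x" "f y" 0] by auto
  have "0 \<notin> f ` I" using assms(3) by force
  then have "(\<forall>s\<in>I. f s > 0) \<or> (\<forall>s\<in>I. f s < 0)"
    using * assms(3) by (metis linorder_neqE_linordered_idom)
  then show thesis
  proof
    assume "\<forall>s\<in>I. f s > 0" then show thesis by (intro that[of 1]) auto
  next
    assume "\<forall>s\<in>I. f s < 0" then show thesis by (intro that[of "-1"]) auto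
  qed
qed

lemma inner_derivative_of_constant:
  fixes f g :: "real \<Rightarrow> 'a::real_inner"
  assumes "open I" "s \<in> I"
    and f: "(f has_vector_derivative f') (at s)" and g: "(g has_vector_derivative g') (at s)"
    and const: "\<And>t. t \<in> I \<Longrightarrow> f t \<bullet> g t = d"
  shows "f' \<bullet> g s + f s \<bullet> g' = 0"
proof -
  have "((\<lambda>t. f t \<bullet> g t) has_vector_derivative (f s \<bullet> g' + f' \<bullet> g s)) (at s)"
    by (rule bounded_bilinear.has_vector_derivative[OF bounded_bilinear_inner f g])
  moreover have "((\<lambda>t. f t \<bullet> g t) has_vector_derivative 0) (at s)"
    by (rule has_vector_derivative_transform_within_open[OF _ \<open>open I\<close> \<open>s \<in> I\<close>, of "\<lambda>_. d"])
       (use const in auto)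
  ultimately show ?thesis by (metis add.commute vector_derivative_unique_at)
qed

section \<open>The Frenet frame\<close>

text \<open>A vector orthogonal to \<open>t\<close> and \<open>n\<close> has zero cross product with \<open>t \<times> n\<close> by Lagrange's formula,
  and a second application of the formula recovers the vector.\<close>

lemma orthogonal_to_pair_imp_multiple_of_cross3:
  fixes t n v :: "real^3"
  assumes "norm t = 1" "norm n = 1" "t \<bullet> n = 0" "v \<bullet> t = 0" "v \<bullet> n = 0"
  shows "v = (v \<bullet> (t \<times> n)) *\<^sub>R (t \<times> n)"
proof -
  have "(norm (t \<times> n))\<^sup>2 = 1" using norm_cross_dot[of t n] assms by simp
  then have "(t \<times> n) \<bullet> (t \<times> n) = 1" by (simp add: power2_norm_eq_inner)
  moreover have "v \<times> (t \<times> n) = 0" using assms by (simp add: Lagrange)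
  ultimately show ?thesis
    using Lagrange[of "t \<times> n" v "t \<times> n"] by (simp add: inner_commute)
qed

lemma smooth_on_vderiv: "smooth_on I f \<Longrightarrow> smooth_on I (vderiv f)"
  unfolding smooth_on_def by (metis comp_apply funpow_Suc_right)

lemma smooth_on_has_vderiv:
  assumes "smooth_on I f" "s \<in> I"
  shows "(f has_vector_derivative vderiv f s) (at s)"
proof -
  have "((vderiv ^^ 0) f) differentiable (at s)" using assms unfolding smooth_on_def by blast
  then show ?thesis by (simp add: vderiv_def vector_derivative_works)
qed

lemma smooth_on_imp_continuous_on: "smooth_on I f \<Longrightarrow> continuous_on I f"
  using smooth_on_has_vderiv
  by (metis continuous_at_imp_continuous_on has_vector_derivative_continuous)

lemma frenet_curve_derivatives:
  assumes "frenet_curve I \<gamma>" "s \<in> I"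
  shows norm_tangent: "norm (tangent \<gamma> s) = 1"
    and curvature_pos: "curvature \<gamma> s > 0"
    and tangent_derivative:
      "(tangent \<gamma> has_vector_derivative curvature \<gamma> s *\<^sub>R normal \<gamma> s) (at s)"
    and norm_normal: "norm (normal \<gamma> s) = 1"
proof -
  show "norm (tangent \<gamma> s) = 1" using assms by (auto simp: frenet_curve_def)
  show pos: "curvature \<gamma> s > 0"
    using assms by (auto simp: frenet_curve_def curvature_def)
  have "smooth_on I (tangent \<gamma>)"
    using assms by (auto simp: frenet_curve_def tangent_def intro: smooth_on_vderiv)
  then show "(tangent \<gamma> has_vector_derivative curvature \<gamma> s *\<^sub>R normal \<gamma> s) (at s)"
    using smooth_on_has_vderiv[OF _ \<open>s \<in> I\<close>, of "tangent \<gamma>"] pos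
    by (simp add: normal_def tangent_def)
  show "norm (normal \<gamma> s) = 1"
    using pos by (simp add: normal_def curvature_def)
qed

lemma continuous_on_second_vderiv:
  assumes "frenet_curve I \<gamma>"
  shows "continuous_on I (vderiv (vderiv \<gamma>))"
  using assms by (auto simp: frenet_curve_def intro: smooth_on_imp_continuous_on smooth_on_vderiv)

lemma continuous_on_curvature:
  assumes "frenet_curve I \<gamma>"
  shows "continuous_on I (curvature \<gamma>)"
  unfolding curvature_def using continuous_on_second_vderiv[OF assms]
  by (rule continuous_on_norm)

lemma tangent_orthogonal_normal:
  assumes "open I" "frenet_curve I \<gamma>" "s \<in> I"
  shows "tangent \<gamma> s \<bullet> normal \<gamma> s = 0"
proof -
  note T' = tangent_derivative[OF assms(2,3)]
  have "tangent \<gamma> t \<bullet> tangent \<gamma> t = 1" if "t \<in> I" for t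
    using norm_tangent[OF assms(2) that] by (simp add: dot_square_norm)
  from inner_derivative_of_constant[OF assms(1,3) T' T' this]
  show ?thesis using curvature_pos[OF assms(2,3)] by (simp add: inner_commute)
qed

lemma normal_differentiable:
  assumes "frenet_curve I \<gamma>" "s \<in> I"
  shows "(normal \<gamma> has_vector_derivative vderiv (normal \<gamma>) s) (at s)"
proof -
  have "smooth_on I (vderiv (vderiv \<gamma>))"
    using assms by (auto simp: frenet_curve_def intro: smooth_on_vderiv)
  from smooth_on_has_vderiv[OF this assms(2)]
  have d: "vderiv (vderiv \<gamma>) differentiable (at s)"
    by (rule differentiableI_vector)
  have nz: "vderiv (vderiv \<gamma>) s \<noteq> 0"
    using curvature_pos[OF assms] by (auto simp: curvature_def)
  have "(\<lambda>t. (1 / norm (vderiv (vderiv \<gamma>) t)) *\<^sub>R vderiv (vderiv \<gamma>) t) differentiable (at s)"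
    using d nz
    by (intro differentiable_scaleR differentiable_divide differentiable_const
        differentiable_compose[where f=norm, OF differentiable_norm_at]) auto
  then have "normal \<gamma> differentiable (at s)"
    by (simp add: normal_def[abs_def] curvature_def)
  then show ?thesis by (simp add: vderiv_def vector_derivative_works)
qed

text \<open>The tangential and normal components of the Frenet equation \<open>N' = -\<kappa> T + \<tau> B\<close>.\<close>

lemma normal_derivative_components:
  assumes "open I" "frenet_curve I \<gamma>" "s \<in> I"
  shows "vderiv (normal \<gamma>) s \<bullet> tangent \<gamma> s = - curvature \<gamma> s"
    and "vderiv (normal \<gamma>) s \<bullet> normal \<gamma> s = 0"
proof -
  note T' = tangent_derivative[OF assms(2,3)]
  note N' = normal_differentiable[OF assms(2,3)]
  have nn: "normal \<gamma> t \<bullet> normal \<gamma> t = 1" if "t \<in> I" for t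
    using norm_normal[OF assms(2) that] by (simp add: dot_square_norm)
  have "normal \<gamma> t \<bullet> tangent \<gamma> t = 0" if "t \<in> I" for t
    using tangent_orthogonal_normal[OF assms(1,2) that] by (simp add: inner_commute)
  from inner_derivative_of_constant[OF assms(1,3) N' T' this] nn[OF assms(3)]
  show "vderiv (normal \<gamma>) s \<bullet> tangent \<gamma> s = - curvature \<gamma> s" by simp
  from inner_derivative_of_constant[OF assms(1,3) N' N' nn]
  show "vderiv (normal \<gamma>) s \<bullet> normal \<gamma> s = 0" by (simp add: inner_commute)
qed

lemma continuous_on_binormal:
  assumes "frenet_curve I \<gamma>"
  shows "continuous_on I (binormal \<gamma>)"
proof -
  have "continuous_on I (tangent \<gamma>)" "continuous_on I (normal \<gamma>)"
    using tangent_derivative[OF assms] normal_differentiable[OF assms]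
    by (meson continuous_at_imp_continuous_on has_vector_derivative_continuous)+
  then show ?thesis
    unfolding binormal_def by (rule continuous_on_cross)
qed

section \<open>Direction curves\<close>

text \<open>For an osculating direction field, the components of its derivative orthogonal to \<open>B\<close> measure
  how far \<open>(b, a)\<close> is from rotating with angular velocity \<open>\<kappa>\<close>.\<close>

lemma osculating_direction_components:
  assumes "open I" "s \<in> I" "frenet_curve I \<alpha>" "smooth_on I \<beta>"
    and \<beta>': "\<And>t. t \<in> I \<Longrightarrow> vderiv \<beta> t = a t *\<^sub>R tangent \<alpha> t + b t *\<^sub>R normal \<alpha> t"
    and a': "(a has_real_derivative a') (at s)" and b': "(b has_real_derivative b') (at s)"
  shows "vderiv (vderiv \<beta>) s \<bullet> tangent \<alpha> s = a' - curvature \<alpha> s * b s"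
    and "vderiv (vderiv \<beta>) s \<bullet> normal \<alpha> s = b' + curvature \<alpha> s * a s"
proof -
  note T' = tangent_derivative[OF assms(3,2)]
  note N' = normal_differentiable[OF assms(3,2)]
  let ?D = "(a s *\<^sub>R (curvature \<alpha> s *\<^sub>R normal \<alpha> s) + a' *\<^sub>R tangent \<alpha> s)
      + (b s *\<^sub>R vderiv (normal \<alpha>) s + b' *\<^sub>R normal \<alpha> s)"
  have "((\<lambda>t. a t *\<^sub>R tangent \<alpha> t + b t *\<^sub>R normal \<alpha> t) has_vector_derivative ?D) (at s)"
    by (intro has_vector_derivative_add has_vector_derivative_scaleR a' b' T' N')
  then have "(vderiv \<beta> has_vector_derivative ?D) (at s)"
    by (rule has_vector_derivative_transform_within_open[OF _ assms(1,2)]) (simp add: \<beta>')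
  moreover have "(vderiv \<beta> has_vector_derivative vderiv (vderiv \<beta>) s) (at s)"
    using smooth_on_has_vderiv[OF smooth_on_vderiv] assms by blast
  ultimately have D: "vderiv (vderiv \<beta>) s = ?D" by (metis vector_derivative_unique_at)
  have "tangent \<alpha> s \<bullet> tangent \<alpha> s = 1" "normal \<alpha> s \<bullet> normal \<alpha> s = 1"
    using norm_tangent[OF assms(3,2)] norm_normal[OF assms(3,2)] by (auto simp: dot_square_norm)
  moreover note tangent_orthogonal_normal[OF assms(1,3,2)]
    normal_derivative_components[OF assms(1,3,2)]
  ultimately show "vderiv (vderiv \<beta>) s \<bullet> tangent \<alpha> s = a' - curvature \<alpha> s * b s"
    and "vderiv (vderiv \<beta>) s \<bullet> normal \<alpha> s = b' + curvature \<alpha> s * a s"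
    unfolding D by (simp_all add: inner_add_left inner_commute[of "normal \<alpha> s" "tangent \<alpha> s"])
qed

theorem proposition4p2:
  fixes I :: "real set" and \<alpha> \<beta> :: "real \<Rightarrow> real ^ 3" and a b c :: "real \<Rightarrow> real"
  assumes "open I" and "is_interval I"
    and "frenet_curve I \<alpha>"
    and "direction_curve I \<alpha> a b c \<beta>"
    and "frenet_curve I \<beta>"
  shows "mannheim_direction_curve I \<alpha> \<beta> \<longleftrightarrow>
    (\<exists>\<theta>. (\<forall>s\<in>I. (\<theta> has_real_derivative curvature \<alpha> s) (at s)) \<and>
         (\<forall>s\<in>I. a s = sin (\<theta> s) \<and> b s = cos (\<theta> s) \<and> c s = 0))"
    (is "_ \<longleftrightarrow> ?rotating")
proof
  have \<beta>': "vderiv \<beta> s = a s *\<^sub>R tangent \<alpha> s + b s *\<^sub>R normal \<alpha> s + c s *\<^sub>R binormal \<alpha> s"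
    if "s \<in> I" for s
    using assms(4) that by (auto simp: direction_curve_def vderiv_def vector_derivative_at)
  have unit: "(a s)\<^sup>2 + (b s)\<^sup>2 + (c s)\<^sup>2 = 1" if "s \<in> I" for s
    using assms(4) that by (auto simp: direction_curve_def)
  have a': "(a has_real_derivative vderiv a s) (at s)"
    and b': "(b has_real_derivative vderiv b s) (at s)" if "s \<in> I" for s
    using assms(4) smooth_on_has_vderiv[OF _ that]
    by (auto simp: direction_curve_def has_real_derivative_iff_has_vector_derivative)
  have smooth: "smooth_on I \<beta>" using assms(5) by (simp add: frenet_curve_def)
  have \<beta>'': "vderiv (vderiv \<beta>) s = curvature \<beta> s *\<^sub>R normal \<beta> s" if "s \<in> I" for s
    using curvature_pos[OF assms(5) that] by (simp add: normal_def)
  have TB: "tangent \<alpha> s \<bullet> binormal \<alpha> s = 0" and NB: "normal \<alpha> s \<bullet> binormal \<alpha> s = 0" for s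
    by (simp_all add: binormal_def dot_cross_self)
  have BB: "norm (binormal \<alpha> s) = 1" if "s \<in> I" for s
  proof -
    have "(norm (binormal \<alpha> s))\<^sup>2 = 1"
      using norm_cross_dot[of "tangent \<alpha> s" "normal \<alpha> s"] norm_tangent[OF assms(3) that]
        norm_normal[OF assms(3) that] tangent_orthogonal_normal[OF assms(1,3) that]
      by (simp add: binormal_def)
    then show ?thesis
      using norm_ge_zero[of "binormal \<alpha> s"] by (auto simp: power2_eq_1_iff simp del: norm_ge_zero)
  qed

  show ?rotating if mannheim: "mannheim_direction_curve I \<alpha> \<beta>"
  proof -
    obtain \<epsilon> :: real where \<epsilon>: "\<epsilon> \<noteq> 0" "\<And>s. s \<in> I \<Longrightarrow> \<epsilon> *\<^sub>R normal \<beta> s = binormal \<alpha> s"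
      using mannheim unfolding mannheim_direction_curve_def mannheim_curve_def
      by (metis insertE singletonD zero_neq_neg_one zero_neq_one)
    have N: "normal \<beta> s = (1 / \<epsilon>) *\<^sub>R binormal \<alpha> s" if "s \<in> I" for s
      using \<epsilon>(1) by (simp flip: \<epsilon>(2)[OF that])
    have c: "c s = 0" if "s \<in> I" for s
    proof -
      have "vderiv \<beta> s \<bullet> binormal \<alpha> s = 0"
        using tangent_orthogonal_normal[OF assms(1,5) that] \<epsilon>(1)
        by (simp add: tangent_def N[OF that])
      then show ?thesis
        using BB[OF that] by (simp add: \<beta>'[OF that] inner_add_left TB NB dot_square_norm)
    qed
    have \<beta>'_osculating: "vderiv \<beta> s = a s *\<^sub>R tangent \<alpha> s + b s *\<^sub>R normal \<alpha> s" if "s \<in> I" for s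
      using \<beta>'[OF that] c[OF that] by simp
    have "vderiv a s = curvature \<alpha> s * b s" "vderiv b s = - (curvature \<alpha> s * a s)"
      if "s \<in> I" for s
      using osculating_direction_components[OF assms(1) that assms(3) smooth \<beta>'_osculating
          a'[OF that] b'[OF that]]
      by (simp_all add: \<beta>''[OF that] N[OF that] inner_commute[of "binormal \<alpha> s"] TB NB)
    with a' b' have
      "\<And>s. s \<in> I \<Longrightarrow> (a has_real_derivative curvature \<alpha> s * b s) (at s)"
      "\<And>s. s \<in> I \<Longrightarrow> (b has_real_derivative - (curvature \<alpha> s * a s)) (at s)"
      by metis+
    moreover have "(a s)\<^sup>2 + (b s)\<^sup>2 = 1" if "s \<in> I" for s
      using unit[OF that] c[OF that] by simp
    ultimately have "\<exists>\<theta>. (\<forall>s\<in>I. (\<theta> has_real_derivative curvature \<alpha> s) (at s)) \<and>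
             (\<forall>s\<in>I. a s = sin (\<theta> s) \<and> b s = cos (\<theta> s))"
      by (intro angle_function_of_rotation assms(1,2) continuous_on_curvature[OF assms(3)])
    with c show ?thesis by metis
  qed

  show "mannheim_direction_curve I \<alpha> \<beta>" if rotating: ?rotating
  proof -
    obtain \<theta> where \<theta>': "\<And>s. s \<in> I \<Longrightarrow> (\<theta> has_real_derivative curvature \<alpha> s) (at s)"
      and abc: "\<And>s. s \<in> I \<Longrightarrow> a s = sin (\<theta> s)" "\<And>s. s \<in> I \<Longrightarrow> b s = cos (\<theta> s)"
        "\<And>s. s \<in> I \<Longrightarrow> c s = 0"
      using rotating by blast
    have \<beta>'_osculating: "vderiv \<beta> s = sin (\<theta> s) *\<^sub>R tangent \<alpha> s + cos (\<theta> s) *\<^sub>R normal \<alpha> s"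
      if "s \<in> I" for s
      using \<beta>'[OF that] abc[OF that] by simp
    define f where "f s = vderiv (vderiv \<beta>) s \<bullet> binormal \<alpha> s" for s
    have fB: "vderiv (vderiv \<beta>) s = f s *\<^sub>R binormal \<alpha> s" if "s \<in> I" for s
    proof -
      have "((\<lambda>t. sin (\<theta> t)) has_real_derivative curvature \<alpha> s * cos (\<theta> s)) (at s)"
        "((\<lambda>t. cos (\<theta> t)) has_real_derivative - (curvature \<alpha> s * sin (\<theta> s))) (at s)"
        using \<theta>'[OF that] by (auto intro!: derivative_eq_intros)
      note osculating_direction_components[OF assms(1) that assms(3) smooth \<beta>'_osculating this]
      then show ?thesis
        unfolding f_def binormal_def
        by (intro orthogonal_to_pair_imp_multiple_of_cross3 norm_tangent[OF assms(3) that]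
            norm_normal[OF assms(3) that] tangent_orthogonal_normal[OF assms(1,3) that]) auto
    qed
    have \<kappa>\<beta>: "curvature \<beta> s = \<bar>f s\<bar>" if "s \<in> I" for s
      using BB[OF that] by (simp add: curvature_def fB[OF that])
    have "f s \<noteq> 0" if "s \<in> I" for s
      using curvature_pos[OF assms(5) that] \<kappa>\<beta>[OF that] by simp
    moreover have "continuous_on I f"
      unfolding f_def
      by (intro continuous_on_inner continuous_on_second_vderiv[OF assms(5)]
          continuous_on_binormal[OF assms(3)])
    ultimately obtain \<epsilon> where \<epsilon>: "\<epsilon> \<in> {1, -1::real}" "\<And>s. s \<in> I \<Longrightarrow> f s = \<epsilon> * \<bar>f s\<bar>"
      using continuous_nonzero_constant_sign[OF assms(2)] by blast
    have "\<epsilon> *\<^sub>R normal \<beta> s = binormal \<alpha> s" if "s \<in> I" for s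
    proof -
      have "normal \<beta> s = (f s / \<bar>f s\<bar>) *\<^sub>R binormal \<alpha> s"
        by (simp add: normal_def \<kappa>\<beta>[OF that] fB[OF that])
      also have "f s / \<bar>f s\<bar> = \<epsilon>"
        using \<epsilon>(2)[OF that] \<open>\<And>s. s \<in> I \<Longrightarrow> f s \<noteq> 0\<close>[OF that]
        by (metis abs_eq_0 nonzero_mult_div_cancel_right)
      finally show ?thesis using \<epsilon>(1) by auto
    qed
    with \<epsilon>(1) assms(3-5) show ?thesis
      unfolding mannheim_direction_curve_def mannheim_curve_def by blast
  qed
qed

end
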